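(* Let $d\ge 4$, let $\Sigma\subseteq\mathbb{C}^d$ be an even-dimensional subspace with $\dim\Sigma\ge 4$, and let $U:\Sigma\to\Sigma$ be an antisymmetric unitary operator. Let $\widehat{U}:\mathbb{C}^d\to\mathbb{C}^d$ be the extension of $U$ by zero, $\widehat{U}(x,y)=(Ux,0)$ for $x\in\Sigma$, $y\in\Sigma^\perp$. Then the map $\varphi^d_{\widehat U}:M_d\to M_d$, $$\varphi^d_{\widehat U}(X)=\mathrm{Tr}(X)\,\mathbb{I}_d - X-\widehat U X^T\widehat U^*,$$ is a positive atomic map.
   Context: $M_d$ is the algebra of $d\times d$ complex matrices (operators on $\mathbb{C}^d$), $M_d^+$ its cone of positive semidefinite elements, $\mathbb{I}_d$ the identity, $X^*$ the adjoint. Transposition $X\mapsto X^T$ is taken with respect to an orthonormal basis $(e_1,\dots,e_d)$ of $\mathbb{C}^d$ such that $\Sigma=\mathrm{span}(e_1,\dots,e_{2k})$, where $2k=\dim\Sigma$; $U$ is antisymmetric means that its matrix in the basis $(e_1,\dots,e_{2k})$ satisfies $U^T=-U$ (so that $\widehat U^T=-\widehat U$). Let $\tau(X)=X^T$. The Schmidt number $\mathrm{SN}(\rho)$ of $\rho\in (M_d\otimes M_d)^+$ is the smallest $r$ such that $\rho$ is a sum of operators $|\psi\rangle\langle\psi|$ with $\psi\in\mathbb{C}^d\otimes\mathbb{C}^d$ of Schmidt rank at most $r$. Put $\mathrm{V}_k=\{\rho\in (M_d\otimes M_d)^+ : \mathrm{SN}(\rho)\le k\}$ and $\mathrm{V}^k=(\mathrm{id}\otimes\tau)\mathrm{V}_k$.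 A linear map $\varphi:M_d\to M_d$ is positive if $\varphi(M_d^+)\subseteq M_d^+$; it is $k$-positive if $(\mathrm{id}\otimes\varphi)(\mathrm{V}_k)\subseteq (M_d\otimes M_d)^+$, and $k$-copositive if $(\mathrm{id}\otimes\varphi)(\mathrm{V}^k)\subseteq (M_d\otimes M_d)^+$ (equivalently, $\varphi\circ\tau$ is $k$-positive). $\mathrm{P}_k$ and $\mathrm{P}^k$ denote the convex cones of $k$-positive and $k$-copositive maps. A map $\varphi$ is atomic if it is positive and $\varphi\notin \mathrm{P}_2+\mathrm{P}^2$. *)

theory Defs
  imports "HOL-Analysis.Analysis"
begin

text \<open>
  \<open>M_d\<close> is \<^typ>\<open>complex^'n^'n\<close> with \<open>d = CARD('n)\<close>, and \<open>M_d \<otimes> M_d\<close> consists of the matrices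
  indexed by \<^typ>\<open>'n \<times> 'n\<close>. The library's \<^const>\<open>inner\<close>, \<^const>\<open>span\<close>, \<^const>\<open>dim\<close> and
  \<^const>\<open>adjoint\<close> are the real ones, so the Hermitian inner product and the complex adjoint are
  defined here, and complex subspaces, spans and dimensions are those of the locale \<open>vec\<close>.
\<close>

definition cinner :: "complex^'m \<Rightarrow> complex^'m \<Rightarrow> complex" where
  "cinner x y = (\<Sum>i\<in>UNIV. cnj (x $ i) * y $ i)"

definition madjoint :: "complex^'m^'n \<Rightarrow> complex^'n^'m" where
  "madjoint A = (\<chi> i j. cnj (A $ j $ i))"

definition ket_bra :: "complex^'m \<Rightarrow> complex^'m \<Rightarrow> complex^'m^'m" where
  "ket_bra x y = (\<chi> i j. x $ i * cnj (y $ j))"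

definition msmult :: "complex \<Rightarrow> complex^'m^'n \<Rightarrow> complex^'m^'n" where
  "msmult c A = (\<chi> i j. c * A $ i $ j)"

text \<open>Over the complex numbers, nonnegativity of the quadratic form includes Hermiticity.\<close>

definition psd :: "complex^'m^'m \<Rightarrow> bool" where
  "psd A \<longleftrightarrow> (\<forall>v. cinner v (A *v v) \<in> \<real>\<^sub>\<ge>\<^sub>0)"

text \<open>An orthonormal basis is indexed by \<open>1, \<dots>, d\<close>; values of the sequence elsewhere are irrelevant.\<close>

definition orthonormal_family :: "nat set \<Rightarrow> (nat \<Rightarrow> complex^'m) \<Rightarrow> bool" where
  "orthonormal_family I e \<longleftrightarrow> (\<forall>i\<in>I. \<forall>j\<in>I. cinner (e i) (e j) = (if i = j then 1 else 0))"

definition orthonormal_basis :: "(nat \<Rightarrow> complex^'n) \<Rightarrow> bool" where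
  "orthonormal_basis e \<longleftrightarrow>
     orthonormal_family {1..CARD('n)} e \<and> vec.span (e ` {1..CARD('n)}) = UNIV"

text \<open>
  Transposition with respect to \<open>e\<close>: the operator whose \<open>(i, j)\<close> matrix entry in the basis \<open>e\<close> is
  the \<open>(j, i)\<close> entry \<open>\<langle>e j, X (e i)\<rangle>\<close> of \<open>X\<close>.
\<close>

definition basis_transpose :: "(nat \<Rightarrow> complex^'n) \<Rightarrow> complex^'n^'n \<Rightarrow> complex^'n^'n" where
  "basis_transpose e X =
     (\<Sum>i\<in>{1..CARD('n)}. \<Sum>j\<in>{1..CARD('n)}.
        msmult (cinner (e j) (X *v e i)) (ket_bra (e i) (e j)))"

definition tensor_vec :: "complex^'n \<Rightarrow> complex^'n \<Rightarrow> complex^('n \<times> 'n)" where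
  "tensor_vec x y = (\<chi> p. x $ fst p * y $ snd p)"

definition tensor_mat :: "complex^'n^'n \<Rightarrow> complex^'n^'n \<Rightarrow> complex^('n \<times> 'n)^('n \<times> 'n)" where
  "tensor_mat A B = (\<chi> p q. A $ fst p $ fst q * B $ snd p $ snd q)"

definition linear_map :: "(complex^'n^'n \<Rightarrow> complex^'n^'n) \<Rightarrow> bool" where
  "linear_map \<phi> \<longleftrightarrow>
     (\<forall>X Y. \<phi> (X + Y) = \<phi> X + \<phi> Y) \<and> (\<forall>c X. \<phi> (msmult c X) = msmult c (\<phi> X))"

text \<open>\<open>id \<otimes> \<phi>\<close> applies \<open>\<phi>\<close> to each block \<open>(\<rho> $ (i, a) $ (j, b))\<^sub>a\<^sub>b\<close>.\<close>

definition id_tensor ::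
  "(complex^'n^'n \<Rightarrow> complex^'n^'n) \<Rightarrow> complex^('n \<times> 'n)^('n \<times> 'n) \<Rightarrow> complex^('n \<times> 'n)^('n \<times> 'n)"
where
  "id_tensor \<phi> \<rho> = (\<chi> p q. \<phi> (\<chi> a b. \<rho> $ (fst p, a) $ (fst q, b)) $ snd p $ snd q)"

lemma id_tensor_tensor_mat:
  assumes "linear_map \<phi>"
  shows "id_tensor \<phi> (tensor_mat A B) = tensor_mat A (\<phi> B)"
proof -
  have "\<phi> (\<chi> a b. A $ i $ j * B $ a $ b) = msmult (A $ i $ j) (\<phi> B)" for i j
    using assms unfolding linear_map_def msmult_def by metis
  then show ?thesis
    by (simp add: id_tensor_def tensor_mat_def vec_eq_iff msmult_def)
qed

lemma id_tensor_add:
  fixes \<phi> :: "complex^'n^'n \<Rightarrow> complex^'n^'n"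
  assumes "linear_map \<phi>"
  shows "id_tensor \<phi> (\<rho> + \<sigma>) = id_tensor \<phi> \<rho> + id_tensor \<phi> \<sigma>"
proof -
  define block where "block \<rho> i j = (\<chi> a b. \<rho> $ (i, a) $ (j, b))"
    for \<rho> :: "complex^('n \<times> 'n)^('n \<times> 'n)" and i j
  have "block (\<rho> + \<sigma>) i j = block \<rho> i j + block \<sigma> i j" for i j
    by (simp add: block_def vec_eq_iff)
  then have "\<phi> (block (\<rho> + \<sigma>) i j) = \<phi> (block \<rho> i j) + \<phi> (block \<sigma> i j)" for i j
    using assms by (simp only: linear_map_def)
  moreover have "id_tensor \<phi> \<rho> = (\<chi> p q. \<phi> (block \<rho> (fst p) (fst q)) $ snd p $ snd q)" for \<rho>
    by (simp add: id_tensor_def block_def)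
  ultimately show ?thesis
    by (simp add: vec_eq_iff[where 'b = "'n \<times> 'n"] vec_eq_iff[where 'a = complex and 'b = "'n \<times> 'n"])
qed

text \<open>
  The number of (positive) coefficients in a Schmidt decomposition; this number is the same for
  all Schmidt decompositions of a given vector.
\<close>

definition schmidt_rank :: "complex^('n::finite \<times> 'n) \<Rightarrow> nat" where
  "schmidt_rank \<psi> = (LEAST r. \<exists>(s :: nat \<Rightarrow> real) a b.
     (\<forall>i<r. s i > 0) \<and> orthonormal_family {..<r} a \<and> orthonormal_family {..<r} b \<and>
     \<psi> = (\<Sum>i<r. complex_of_real (s i) *s tensor_vec (a i) (b i)))"

definition schmidt_number :: "complex^('n::finite \<times> 'n)^('n \<times> 'n) \<Rightarrow> nat" where
  "schmidt_number \<rho> = (LEAST r. \<exists>(m :: nat) \<psi>.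
     (\<forall>i<m. schmidt_rank (\<psi> i) \<le> r) \<and> \<rho> = (\<Sum>i<m. ket_bra (\<psi> i) (\<psi> i)))"

definition V_sub :: "nat \<Rightarrow> (complex^('n::finite \<times> 'n)^('n \<times> 'n)) set" where
  "V_sub k = {\<rho>. psd \<rho> \<and> schmidt_number \<rho> \<le> k}"

definition V_sup :: "(nat \<Rightarrow> complex^'n) \<Rightarrow> nat \<Rightarrow> (complex^('n \<times> 'n)^('n \<times> 'n)) set" where
  "V_sup e k = id_tensor (basis_transpose e) ` V_sub k"

definition positive_map :: "(complex^'n^'n \<Rightarrow> complex^'n^'n) \<Rightarrow> bool" where
  "positive_map \<phi> \<longleftrightarrow> linear_map \<phi> \<and> (\<forall>X. psd X \<longrightarrow> psd (\<phi> X))"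

definition P_sub :: "nat \<Rightarrow> (complex^'n^'n \<Rightarrow> complex^'n^'n) set" where
  "P_sub k = {\<phi>. linear_map \<phi> \<and> (\<forall>\<rho>\<in>V_sub k. psd (id_tensor \<phi> \<rho>))}"

definition P_sup :: "(nat \<Rightarrow> complex^'n) \<Rightarrow> nat \<Rightarrow> (complex^'n^'n \<Rightarrow> complex^'n^'n) set" where
  "P_sup e k = {\<phi>. linear_map \<phi> \<and> (\<forall>\<rho>\<in>V_sup e k. psd (id_tensor \<phi> \<rho>))}"

definition atomic_map :: "(nat \<Rightarrow> complex^'n) \<Rightarrow> (complex^'n^'n \<Rightarrow> complex^'n^'n) \<Rightarrow> bool" where
  "atomic_map e \<phi> \<longleftrightarrow> positive_map \<phi> \<and>
     \<not> (\<exists>\<phi>\<^sub>1\<in>P_sub 2. \<exists>\<phi>\<^sub>2\<in>P_sup e 2. \<phi> = (\<lambda>X. \<phi>\<^sub>1 X + \<phi>\<^sub>2 X))"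

definition orth_compl :: "(complex^'n) set \<Rightarrow> (complex^'n) set" where
  "orth_compl \<Sigma> = {y. \<forall>x\<in>\<Sigma>. cinner x y = 0}"

text \<open>Only the restriction of \<open>U\<close> to \<open>\<Sigma>\<close> matters.\<close>

definition unitary_on :: "(complex^'n) set \<Rightarrow> (complex^'n \<Rightarrow> complex^'n) \<Rightarrow> bool" where
  "unitary_on \<Sigma> U \<longleftrightarrow>
     (\<forall>x\<in>\<Sigma>. \<forall>y\<in>\<Sigma>. U (x + y) = U x + U y) \<and> (\<forall>c. \<forall>x\<in>\<Sigma>. U (c *s x) = c *s U x) \<and>
     U ` \<Sigma> = \<Sigma> \<and> (\<forall>x\<in>\<Sigma>. \<forall>y\<in>\<Sigma>. cinner (U x) (U y) = cinner x y)"

definition antisymmetric_in :: "nat set \<Rightarrow> (nat \<Rightarrow> complex^'n) \<Rightarrow> (complex^'n \<Rightarrow> complex^'n) \<Rightarrow> bool"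
where
  "antisymmetric_in I e U \<longleftrightarrow> (\<forall>i\<in>I. \<forall>j\<in>I. cinner (e i) (U (e j)) = - cinner (e j) (U (e i)))"

text \<open>\<open>U'\<close> is determined uniquely, since every vector splits as \<open>x + y\<close> with \<open>x \<in> \<Sigma>\<close>, \<open>y \<in> \<Sigma>\<^sup>\<bottom>\<close>.\<close>

definition zero_extension ::
  "(complex^'n) set \<Rightarrow> (complex^'n \<Rightarrow> complex^'n) \<Rightarrow> complex^'n^'n \<Rightarrow> bool"
where
  "zero_extension \<Sigma> U U' \<longleftrightarrow> (\<forall>x\<in>\<Sigma>. \<forall>y\<in>orth_compl \<Sigma>. U' *v (x + y) = U x)"

definition phi_map :: "(nat \<Rightarrow> complex^'n) \<Rightarrow> complex^'n^'n \<Rightarrow> complex^'n^'n \<Rightarrow> complex^'n^'n" where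
  "phi_map e W X = mat (trace X) - X - W ** basis_transpose e X ** madjoint W"

end

theory Submission
  imports Defs
begin

text \<open>
  Let \<open>J x\<close> be the extension of \<open>U\<close> applied to the complex conjugate of \<open>x\<close>. Antisymmetry says
  \<open>\<langle>x, J y\<rangle> = - \<langle>y, J x\<rangle>\<close>, so \<open>J x\<close> is orthogonal to \<open>x\<close> and no longer than \<open>x\<close>. The quadratic form
  of \<open>\<phi>(X)\<close> at a vector \<open>v\<close> is \<open>Tr X |v|\<^sup>2 - \<langle>v, X v\<rangle> - \<langle>J v, X (J v)\<rangle>\<close>, which is nonnegative by
  Bessel's inequality for the form \<open>X\<close>.

  For atomicity, choose a unit vector \<open>f 1\<close> in \<open>\<Sigma>\<close>, put \<open>f 2 = J (f 1)\<close>, choose a unit vector \<open>f 3\<close> in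
  \<open>\<Sigma>\<close> orthogonal to both, and put \<open>f 4 = J (f 3)\<close>; this is an orthonormal family on which \<open>J\<close> is known
  completely. In this frame there is an operator of Schmidt number at most 2 whose partial transpose
  also has Schmidt number at most 2. Pairing with it is nonnegative on 2-positive and on 2-copositive
  maps, but gives \<open>-8\<close> on the map in question.
\<close>

section \<open>The Hermitian inner product\<close>

lemma cinner_add_left: "cinner (x + y) z = cinner x z + cinner y z"
  by (simp add: cinner_def algebra_simps sum.distrib)

lemma cinner_add_right: "cinner x (y + z) = cinner x y + cinner x z"
  by (simp add: cinner_def algebra_simps sum.distrib)

lemma cinner_diff_left: "cinner (x - y) z = cinner x z - cinner y z"
  by (simp add: cinner_def algebra_simps sum_subtractf)

lemma cinner_diff_right: "cinner x (y - z) = cinner x y - cinner x z"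
  by (simp add: cinner_def algebra_simps sum_subtractf)

lemma cinner_scale_left [simp]: "cinner (c *s x) y = cnj c * cinner x y"
  by (simp add: cinner_def sum_distrib_left mult_ac)

lemma cinner_scale_right [simp]: "cinner x (c *s y) = c * cinner x y"
  by (simp add: cinner_def sum_distrib_left mult_ac)

lemma cinner_zero_left [simp]: "cinner 0 x = 0"
  by (simp add: cinner_def)

lemma cinner_zero_right [simp]: "cinner x 0 = 0"
  by (simp add: cinner_def)

lemma cinner_minus_right [simp]: "cinner x (- y) = - cinner x y"
  using cinner_diff_right[of x 0 y] by simp

lemma cinner_minus_left [simp]: "cinner (- x) y = - cinner x y"
  using cinner_diff_left[of 0 x y] by simp

lemma cinner_sum_left: "cinner (sum f A) y = (\<Sum>i\<in>A. cinner (f i) y)"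
  by (induction A rule: infinite_finite_induct) (simp_all add: cinner_add_left)

lemma cinner_sum_right: "cinner x (sum f A) = (\<Sum>i\<in>A. cinner x (f i))"
  by (induction A rule: infinite_finite_induct) (simp_all add: cinner_add_right)

lemma cnj_cinner [simp]: "cnj (cinner x y) = cinner y x"
  by (simp add: cinner_def mult.commute)

lemma cinner_self: "cinner x x = complex_of_real ((norm x)\<^sup>2)"
  by (simp add: cinner_def norm_vec_def L2_set_def sum_nonneg complex_norm_square mult.commute
      flip: of_real_power)

lemma cinner_axis_left: "cinner (axis c 1) x = x $ c"
  by (simp add: cinner_def axis_def if_distrib if_distribR cong: if_cong)

lemma cinner_eq_rightI:
  assumes "\<And>u. cinner u x = cinner u y"
  shows "x = y"
  unfolding vec_eq_iff using assms cinner_axis_left by metis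

lemma cinner_axis_mult_axis: "cinner (axis c 1) (A *v axis c 1) = A $ c $ c"
  unfolding cinner_axis_left by (simp add: matrix_vector_mult_def axis_def if_distrib cong: if_cong)

lemma cinner_mult_vec: "cinner u (A *v v) = cinner (madjoint A *v u) v"
proof -
  have "cinner u (A *v v) = (\<Sum>i\<in>UNIV. \<Sum>j\<in>UNIV. cnj (u $ i) * (A $ i $ j * v $ j))"
    by (simp add: cinner_def matrix_vector_mult_def sum_distrib_left)
  also have "\<dots> = (\<Sum>j\<in>UNIV. \<Sum>i\<in>UNIV. cnj (u $ i) * (A $ i $ j * v $ j))"
    by (rule sum.swap)
  also have "\<dots> = cinner (madjoint A *v u) v"
    by (simp add: cinner_def madjoint_def matrix_vector_mult_def sum_distrib_left sum_distrib_right
        mult_ac)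
  finally show ?thesis .
qed

lemma matrix_eq_cinnerI:
  fixes A B :: "complex^'m^'m"
  assumes "\<And>u v. cinner u (A *v v) = cinner u (B *v v)"
  shows "A = B"
  unfolding matrix_eq using assms cinner_eq_rightI by metis

lemma mult_vec_sum: "A *v sum f S = (\<Sum>i\<in>S. A *v f i)"
  by (induction S rule: infinite_finite_induct) (simp_all add: matrix_vector_right_distrib)

lemma sum_mult_vec: "sum F S *v v = (\<Sum>i\<in>S. F i *v v)"
  by (induction S rule: infinite_finite_induct) (simp_all add: matrix_vector_mult_add_rdistrib)

lemma msmult_mult_vec [simp]: "msmult c A *v v = c *s (A *v v)"
  by (simp add: vec_eq_iff matrix_vector_mult_def msmult_def sum_distrib_left mult_ac)

lemma ket_bra_mult_vec [simp]: "ket_bra x y *v v = cinner y v *s x"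
  by (simp add: vec_eq_iff matrix_vector_mult_def ket_bra_def cinner_def sum_distrib_left
      sum_distrib_right mult_ac)

lemma trace_ket_bra: "trace (ket_bra x y) = cinner y x"
  by (simp add: trace_def ket_bra_def cinner_def mult.commute)

lemma mat_mult_vec: "mat c *v (v :: complex^'m) = c *s v"
  by (simp add: vec_eq_iff matrix_vector_mult_def mat_def if_distrib if_distribR cong: if_cong)

text \<open>With P the orthogonal projection onto the span of the family, the difference is Tr((1 -
  P) X (1 - P)), a sum of values of the nonnegative form of \<open>X\<close>.\<close>

lemma Bessel_psd:
  fixes X :: "complex^'m^'m"
  assumes "psd X" and g: "orthonormal_family F g" and "finite F"
  shows "trace X - (\<Sum>i\<in>F. cinner (g i) (X *v g i)) \<in> \<real>\<^sub>\<ge>\<^sub>0"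
proof -
  \<comment> \<open>\<open>q c\<close> is P applied to the \<open>c\<close>-th standard basis
    vector. The two mixed sums and the pure one below all equal \<open>S\<close>.\<close>
  define q where "q c = (\<Sum>i\<in>F. cnj (g i $ c) *s g i)" for c
  define S where "S = (\<Sum>i\<in>F. cinner (g i) (X *v g i))"
  let ?a = "\<lambda>c. axis c 1 :: complex^'m"
  have "(\<Sum>c\<in>UNIV. cinner (?a c) (X *v q c)) = (\<Sum>c\<in>UNIV. \<Sum>i\<in>F. cnj (g i $ c) * (X *v g i) $ c)"
    by (simp add: q_def mult_vec_sum cinner_axis_left vec.scale)
  also have "\<dots> = S"
    by (subst sum.swap) (simp add: S_def cinner_def)
  finally have 1: "(\<Sum>c\<in>UNIV. cinner (?a c) (X *v q c)) = S" .
  have "(\<Sum>c\<in>UNIV. cinner (q c) (X *v ?a c)) = (\<Sum>c\<in>UNIV. \<Sum>i\<in>F. g i $ c * cinner (g i) (X *v ?a c))"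
    by (simp add: q_def cinner_sum_left)
  also have "\<dots> = (\<Sum>i\<in>F. cinner (g i) (X *v (\<Sum>c\<in>UNIV. g i $ c *s ?a c)))"
    by (subst sum.swap) (simp add: cinner_sum_right mult_vec_sum vec.scale)
  also have "\<dots> = S"
    by (simp add: S_def basis_expansion)
  finally have 2: "(\<Sum>c\<in>UNIV. cinner (q c) (X *v ?a c)) = S" .
  have "(\<Sum>c\<in>UNIV. cinner (q c) (X *v q c))
      = (\<Sum>c\<in>UNIV. \<Sum>i\<in>F. \<Sum>j\<in>F. cnj (g i $ c) * g j $ c * cinner (g j) (X *v g i))"
    by (simp add: q_def cinner_sum_left cinner_sum_right mult_vec_sum vec.scale sum_distrib_left mult_ac)
  also have "\<dots> = (\<Sum>i\<in>F. \<Sum>j\<in>F. \<Sum>c\<in>UNIV. cnj (g i $ c) * g j $ c * cinner (g j) (X *v g i))"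
    by (subst sum.swap, rule sum.cong[OF refl], subst sum.swap) (rule refl)
  also have "\<dots> = (\<Sum>i\<in>F. \<Sum>j\<in>F. cinner (g i) (g j) * cinner (g j) (X *v g i))"
    by (simp add: cinner_def[of "g _" "g _"] sum_distrib_right)
  also have "\<dots> = (\<Sum>i\<in>F. \<Sum>j\<in>F. if i = j then cinner (g i) (X *v g i) else 0)"
    using g unfolding orthonormal_family_def by (intro sum.cong) auto
  also have "\<dots> = S"
    using \<open>finite F\<close> by (simp add: S_def)
  finally have 3: "(\<Sum>c\<in>UNIV. cinner (q c) (X *v q c)) = S" .
  have "trace X - S = (\<Sum>c\<in>UNIV. cinner (?a c - q c) (X *v (?a c - q c)))"
    by (simp add: matrix_vector_mult_diff_distrib cinner_diff_left cinner_diff_right sum_subtractf 1 2 3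
        cinner_axis_mult_axis trace_def)
  also have "\<dots> \<in> \<real>\<^sub>\<ge>\<^sub>0"
    using \<open>psd X\<close> by (simp add: psd_def complex_nonneg_Reals_iff sum_nonneg)
  finally show ?thesis
    by (simp add: S_def)
qed

lemma orthonormal_family_scale:
  assumes "cinner (v 0) (v 1) = 0" "v 0 \<noteq> 0" "v 1 \<noteq> 0"
  shows "orthonormal_family {..<2::nat} (\<lambda>i. complex_of_real (1 / norm (v i)) *s v i)"
proof -
  have "cinner (v 1) (v 0) = 0"
    using assms(1) by (metis cnj_cinner complex_cnj_zero)
  with assms show ?thesis
    by (auto simp: orthonormal_family_def numeral_2_eq_2 less_Suc_eq cinner_self power2_eq_square)
qed

text \<open>For the normalized vectors Bessel gives a/|v|^2 + b/|w|^2 <= Tr X, where a and b are the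
  values of the form at \<open>v\<close> and \<open>w\<close>. Enlarging the second denominator to
  |v|^2 gives the claim; zero vectors cannot be normalized and are treated separately.\<close>

lemma orthogonal_pair_psd:
  fixes X :: "complex^'m^'m"
  assumes X: "psd X" and vw: "cinner v w = 0" and le: "norm w \<le> norm v"
  shows "trace X * cinner v v - cinner v (X *v v) - cinner w (X *v w) \<in> \<real>\<^sub>\<ge>\<^sub>0"
proof -
  have nn: "cinner x (X *v x) \<in> \<real>\<^sub>\<ge>\<^sub>0" for x
    using X by (simp add: psd_def)
  define n where "n = (norm v)\<^sup>2"
  define m where "m = (norm w)\<^sup>2"
  define a where "a = Re (cinner v (X *v v))"
  define b where "b = Re (cinner w (X *v w))"
  define t where "t = Re (trace X)"
  have a: "cinner v (X *v v) = of_real a" "a \<ge> 0" and b: "cinner w (X *v w) = of_real b" "b \<ge> 0"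
    using nn[of v] nn[of w] by (auto simp: a_def b_def complex_nonneg_Reals_iff complex_eq_iff)
  have "trace X \<in> \<real>\<^sub>\<ge>\<^sub>0"
    \<comment> \<open>The empty family turns Bessel into nonnegativity of the trace.\<close>
    using Bessel_psd[OF X, of "{}"] by (simp add: orthonormal_family_def)
  then have t: "trace X = of_real t" "t \<ge> 0"
    by (auto simp: t_def complex_nonneg_Reals_iff complex_eq_iff)
  have "m \<le> n"
    unfolding m_def n_def using le by (simp add: power_mono)
  have "a + b \<le> t * n"
  proof (cases "v = 0")
    case True
    with le show ?thesis by (simp add: n_def a_def b_def)
  next
    case False
    define f where "f i = (if i = (0::nat) then v else w)" for i
    define g where "g i = complex_of_real (1 / norm (f i)) *s f i" for i
    have g: "cinner (g 0) (X *v g 0) = of_real (a / n)" "cinner (g 1) (X *v g 1) = of_real (b / m)"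
      using a b by (simp_all add: g_def f_def vec.scale n_def m_def power2_eq_square)
    have n: "n > 0" using False by (simp add: n_def)
    show ?thesis
    proof (cases "w = 0")
      case True
      have "orthonormal_family {0} g"
        using False by (simp add: orthonormal_family_def g_def f_def)
          (simp add: cinner_self power2_eq_square)
      from Bessel_psd[OF X this] have "a / n \<le> t"
        by (simp add: g t complex_nonneg_Reals_iff)
      moreover have "b = 0" using True by (simp add: b_def)
      ultimately show ?thesis using n by (simp add: field_simps)
    next
      case w: False
      then have m: "m > 0" by (simp add: m_def)
      have "orthonormal_family {..<2} g"
        unfolding g_def[abs_def]
        by (rule orthonormal_family_scale) (use vw False w in \<open>simp_all add: f_def\<close>)
      from Bessel_psd[OF X this] have "a / n + b / m \<le> t"
        by (simp add: g[simplified] t complex_nonneg_Reals_iff numeral_2_eq_2)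
      moreover have "b / n \<le> b / m"
        using b m \<open>m \<le> n\<close> by (simp add: frac_le)
      ultimately have "(a + b) / n \<le> t"
        by (simp add: add_divide_distrib)
      then show ?thesis using n by (simp add: field_simps)
    qed
  qed
  moreover have "trace X * cinner v v - cinner v (X *v v) - cinner w (X *v w) = of_real (t * n - a - b)"
    by (simp add: a b t cinner_self n_def)
  ultimately show ?thesis
    by (simp add: complex_nonneg_Reals_iff del: of_real_diff of_real_mult)
qed

section \<open>Vectors and matrices on the tensor square\<close>

lemma sum_prod_UNIV: "(\<Sum>p\<in>(UNIV :: ('a::finite \<times> 'b::finite) set). f (fst p) * g (snd p))
    = (\<Sum>a\<in>UNIV. f a) * ((\<Sum>b\<in>UNIV. g b) :: complex)"
  by (simp add: sum_product sum.cartesian_product flip: UNIV_Times_UNIV) (simp add: case_prod_unfold)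

lemma cinner_tensor_vec: "cinner (tensor_vec a b) (tensor_vec c d) = cinner a c * cinner b d"
  using sum_prod_UNIV[of "\<lambda>i. cnj (a $ i) * c $ i" "\<lambda>i. cnj (b $ i) * d $ i"]
  by (simp add: cinner_def tensor_vec_def mult_ac)

lemma tensor_mat_mult_vec: "tensor_mat A B *v tensor_vec x y = tensor_vec (A *v x) (B *v y)"
  using sum_prod_UNIV[of "\<lambda>i. A $ _ $ i * x $ i" "\<lambda>i. B $ _ $ i * y $ i"]
  by (simp add: vec_eq_iff tensor_mat_def tensor_vec_def matrix_vector_mult_def mult_ac)

lemma ket_bra_sum: "ket_bra (sum f S) (sum f S) = (\<Sum>i\<in>S. \<Sum>j\<in>S. ket_bra (f i) (f j))"
  by (simp add: vec_eq_iff ket_bra_def sum_product)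

lemma ket_bra_tensor_vec:
  "ket_bra (tensor_vec a b) (tensor_vec c d) = tensor_mat (ket_bra a c) (ket_bra b d)"
  by (simp add: vec_eq_iff ket_bra_def tensor_vec_def tensor_mat_def mult_ac)

lemma id_tensor_sum:
  assumes "linear_map \<phi>"
  shows "id_tensor \<phi> (sum f S) = (\<Sum>i\<in>S. id_tensor \<phi> (f i))"
proof (induction S rule: infinite_finite_induct)
  case empty
  have "id_tensor \<phi> 0 = 0"
    using id_tensor_add[OF assms, of 0 0] by simp
  then show ?case by simp
qed (simp_all add: id_tensor_add[OF assms] id_tensor_add[OF assms, of 0 0, simplified])

lemma psd_ket_bra: "psd (ket_bra x x)"
proof -
  have "cinner x v * cinner v x = of_real ((cmod (cinner x v))\<^sup>2)" for v
    by (metis cnj_cinner complex_norm_square of_real_power)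
  then show ?thesis
    by (simp add: psd_def complex_nonneg_Reals_iff del: of_real_power)
qed

section \<open>Testing positivity on pure states of bounded Schmidt rank\<close>

lemma ket_bra_in_V_sub:
  assumes "schmidt_rank \<psi> \<le> r"
  shows "ket_bra \<psi> \<psi> \<in> V_sub r"
  unfolding V_sub_def schmidt_number_def using assms
  by (auto simp: psd_ket_bra intro!: Least_le exI[of _ "Suc 0"] exI[of _ "\<lambda>_. \<psi>"])

text \<open>The sum is already a Schmidt decomposition with all coefficients 1, so \<open>r\<close>
  is a candidate for the minimum.\<close>

lemma schmidt_rank_sum_tensor_vec:
  assumes "orthonormal_family {..<r} x"
  shows "schmidt_rank (\<Sum>i<r. tensor_vec (x i) (x i)) \<le> r"
  unfolding schmidt_rank_def using assms
  by (intro Least_le exI[of _ "\<lambda>_. 1"] exI[of _ x]) simp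

text \<open>The form in which \<open>r\<close>-positivity gets used. Orthonormality of the
  \<open>x i\<close> makes the test vector \<open>v\<close> pick out the individual blocks of the
  image of the pure state, while the \<open>y i\<close> remain arbitrary.\<close>

lemma P_sub_form:
  assumes \<phi>: "\<phi> \<in> P_sub r" and x: "orthonormal_family {..<r} x"
  shows "(\<Sum>i<r. \<Sum>j<r. cinner (y i) (\<phi> (ket_bra (x i) (x j)) *v y j)) \<in> \<real>\<^sub>\<ge>\<^sub>0"
proof -
  have lin: "linear_map \<phi>"
    using \<phi> by (simp add: P_sub_def)
  define \<psi> where "\<psi> = (\<Sum>i<r. tensor_vec (x i) (x i))"
  define v where "v = (\<Sum>i<r. tensor_vec (x i) (y i))"
  have M: "id_tensor \<phi> (ket_bra \<psi> \<psi>)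
      = (\<Sum>i<r. \<Sum>j<r. tensor_mat (ket_bra (x i) (x j)) (\<phi> (ket_bra (x i) (x j))))"
    by (simp add: \<psi>_def ket_bra_sum ket_bra_tensor_vec id_tensor_sum[OF lin]
        id_tensor_tensor_mat[OF lin])
  have "tensor_mat (ket_bra (x i) (x j)) B *v v = tensor_vec (x i) (B *v y j)" if "i < r" "j < r" for i j B
  proof -
    have "tensor_mat (ket_bra (x i) (x j)) B *v v = (\<Sum>m<r. if m = j then tensor_vec (x i) (B *v y j) else 0)"
      unfolding v_def mult_vec_sum tensor_mat_mult_vec ket_bra_mult_vec
      using x that by (intro sum.cong) (auto simp: orthonormal_family_def tensor_vec_def vec_eq_iff)
    then show ?thesis using that by simp
  qed
  moreover have "cinner v (tensor_vec (x i) z) = cinner (y i) z" if "i < r" for i z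
  proof -
    have "cinner v (tensor_vec (x i) z) = (\<Sum>m<r. if m = i then cinner (y i) z else 0)"
      unfolding v_def cinner_sum_left cinner_tensor_vec
      using x that by (intro sum.cong) (auto simp: orthonormal_family_def)
    then show ?thesis using that by simp
  qed
  ultimately have "cinner v (id_tensor \<phi> (ket_bra \<psi> \<psi>) *v v)
      = (\<Sum>i<r. \<Sum>j<r. cinner (y i) (\<phi> (ket_bra (x i) (x j)) *v y j))"
    by (simp add: M sum_mult_vec cinner_sum_right)
  moreover have "psd (id_tensor \<phi> (ket_bra \<psi> \<psi>))"
    using \<phi> ket_bra_in_V_sub[OF schmidt_rank_sum_tensor_vec[OF x]] by (simp add: P_sub_def \<psi>_def)
  ultimately show ?thesis
    by (metis psd_def)
qed

section \<open>Conjugation and transposition in an orthonormal basis\<close>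

text \<open>The coefficient \<open>cinner x (e i)\<close> is the conjugate of the
  \<open>i\<close>-th coordinate of \<open>x\<close>, so this is an antilinear map, called C
  below.\<close>

definition basis_cnj :: "(nat \<Rightarrow> complex^'n) \<Rightarrow> complex^'n \<Rightarrow> complex^'n" where
  "basis_cnj e x = (\<Sum>i\<in>{1..CARD('n)}. cinner x (e i) *s e i)"

lemma orthonormal_expand:
  assumes g: "orthonormal_family I g" and "finite I" and x: "x \<in> vec.span (g ` I)"
  shows "x = (\<Sum>i\<in>I. cinner (g i) x *s g i)"
  using x
proof (induction rule: vec.span_induct_alt)
  case (step c z y)
  then obtain j where j: "j \<in> I" "z = g j" by blast
  have "(\<Sum>i\<in>I. cinner (g i) z *s g i) = (\<Sum>i\<in>I. if i = j then g j else 0)"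
    using g j by (intro sum.cong) (auto simp: orthonormal_family_def)
  with j \<open>finite I\<close> have z: "(\<Sum>i\<in>I. cinner (g i) z *s g i) = z" by simp
  have "(\<Sum>i\<in>I. cinner (g i) (c *s z + y) *s g i)
      = c *s (\<Sum>i\<in>I. cinner (g i) z *s g i) + (\<Sum>i\<in>I. cinner (g i) y *s g i)"
    by (simp add: cinner_add_right vec.scale_left_distrib sum.distrib vec.scale_sum_right)
  with z step.IH show ?case by simp
qed simp

context
  fixes e :: "nat \<Rightarrow> complex^'n"
  assumes e: "orthonormal_basis e"
begin

lemma basis_expand: "x = (\<Sum>i\<in>{1..CARD('n)}. cinner (e i) x *s e i)"
  using e by (intro orthonormal_expand) (auto simp: orthonormal_basis_def)

lemma basis_cinner:
  "i \<in> {1..CARD('n)} \<Longrightarrow> j \<in> {1..CARD('n)} \<Longrightarrow> cinner (e i) (e j) = (if i = j then 1 else 0)"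
  using e unfolding orthonormal_basis_def orthonormal_family_def by blast

lemma cinner_basis_cnj: "i \<in> {1..CARD('n)} \<Longrightarrow> cinner (e i) (basis_cnj e x) = cinner x (e i)"
  by (simp add: basis_cnj_def cinner_sum_right basis_cinner if_distrib cong: if_cong del: atLeastAtMost_iff)

lemma basis_cnj_basis_cnj [simp]: "basis_cnj e (basis_cnj e x) = x"
proof -
  have "basis_cnj e (basis_cnj e x) = (\<Sum>i\<in>{1..CARD('n)}. cinner (e i) x *s e i)"
    unfolding basis_cnj_def[of e "basis_cnj e x"]
    by (intro sum.cong refl) (metis cinner_basis_cnj cnj_cinner)
  then show ?thesis using basis_expand by metis
qed

text \<open>Both sides are the symmetric bilinear form summing the products of the coordinates of
  \<open>x\<close> and \<open>y\<close>.\<close>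

lemma cinner_basis_cnj_left: "cinner (basis_cnj e x) y = cinner (basis_cnj e y) x"
  by (simp add: basis_cnj_def cinner_sum_left mult.commute)

lemma cinner_basis_cnj_basis_cnj: "cinner (basis_cnj e x) (basis_cnj e y) = cinner y x"
  by (metis basis_cnj_basis_cnj cinner_basis_cnj_left)

text \<open>This is X^T = C X^* C written as a form; it replaces the double sum over the basis from
  here on.\<close>

lemma basis_transpose_form:
  "cinner u (basis_transpose e X *v v) = cinner (basis_cnj e v) (X *v basis_cnj e u)"
proof -
  have "cinner (basis_cnj e v) (X *v basis_cnj e u)
      = (\<Sum>i\<in>{1..CARD('n)}. \<Sum>j\<in>{1..CARD('n)}.
          cinner (e j) (X *v e i) * cinner u (e i) * cinner (e j) v)"
    by (simp add: basis_cnj_def cinner_sum_left cinner_sum_right mult_vec_sum vec.scale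
        sum_distrib_left mult_ac)
  then show ?thesis
    by (simp add: basis_transpose_def sum_mult_vec cinner_sum_right mult_ac)
qed

lemma basis_transpose_ket_bra:
  "basis_transpose e (ket_bra x y) = ket_bra (basis_cnj e y) (basis_cnj e x)"
proof (rule matrix_eq_cinnerI)
  fix u v
  have "cinner (basis_cnj e v) x = cinner (basis_cnj e x) v" "cinner y (basis_cnj e u) = cinner u (basis_cnj e y)"
    by (metis cinner_basis_cnj_left, metis cinner_basis_cnj_left cnj_cinner)
  then show "cinner u (basis_transpose e (ket_bra x y) *v v)
      = cinner u (ket_bra (basis_cnj e y) (basis_cnj e x) *v v)"
    by (simp add: basis_transpose_form)
qed

lemma linear_map_basis_transpose: "linear_map (basis_transpose e)"
  unfolding linear_map_def
  by (intro conjI allI matrix_eq_cinnerI)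
     (simp_all add: basis_transpose_form matrix_vector_mult_add_rdistrib cinner_add_right)

lemma P_sup_comp_basis_transpose:
  assumes "\<phi> \<in> P_sup e r"
  shows "\<phi> \<circ> basis_transpose e \<in> P_sub r"
proof -
  have "linear_map \<phi>"
    using assms by (simp add: P_sup_def)
  moreover have "id_tensor \<phi> (id_tensor (basis_transpose e) \<rho>) = id_tensor (\<phi> \<circ> basis_transpose e) \<rho>" for \<rho>
    by (simp add: id_tensor_def)
  ultimately show ?thesis
    using assms linear_map_basis_transpose
    by (auto simp: P_sub_def P_sup_def V_sup_def linear_map_def)
qed

text \<open>Composing with transposition gives an \<open>r\<close>-positive map. Testing that map at
  the conjugated vectors lets transposition undo the conjugation, so that only the swap of ket and
  bra remains.\<close>

lemma P_sup_form:
  assumes \<phi>: "\<phi> \<in> P_sup e r" and x: "orthonormal_family {..<r} x"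
  shows "(\<Sum>i<r. \<Sum>j<r. cinner (y i) (\<phi> (ket_bra (x j) (x i)) *v y j)) \<in> \<real>\<^sub>\<ge>\<^sub>0"
proof -
  have "orthonormal_family {..<r} (\<lambda>i. basis_cnj e (x i))"
    using x unfolding orthonormal_family_def by (metis cinner_basis_cnj_basis_cnj)
  from P_sub_form[OF P_sup_comp_basis_transpose[OF \<phi>] this, of y] show ?thesis
    by (simp add: basis_transpose_ket_bra)
qed

end

text \<open>A plane meets the hyperplane orthogonal to \<open>y\<close> in a nonzero vector.\<close>

lemma exists_unit_orthogonal:
  assumes "orthonormal_family {1, 2::nat} g"
  obtains x where "x \<in> vec.span {g 1, g 2}" "cinner x x = 1" "cinner y x = 0"
proof -
  have g: "cinner (g 1) (g 1) = 1" "cinner (g 2) (g 2) = 1" "cinner (g 1) (g 2) = 0" "cinner (g 2) (g 1) = 0"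
    using assms by (auto simp: orthonormal_family_def)
  \<comment> \<open>The case split keeps \<open>z\<close> nonzero: in the second case its
    coefficient at \<open>g 2\<close> does not vanish.\<close>
  define z where "z = (if cinner y (g 1) = 0 then g 1
    else cinner y (g 2) *s g 1 - cinner y (g 1) *s g 2)"
  have z: "cinner y z = 0" "z \<in> vec.span {g 1, g 2}"
    by (auto simp: z_def cinner_diff_right vec.span_base intro!: vec.span_diff vec.span_scale)
  have "cinner (g 1) z \<noteq> 0 \<or> cinner (g 2) z \<noteq> 0"
    by (auto simp: z_def cinner_diff_right g[simplified])
  then have "z \<noteq> 0" by auto
  show ?thesis
  proof (rule that[of "complex_of_real (1 / norm z) *s z"])
    show "cinner (complex_of_real (1 / norm z) *s z) (complex_of_real (1 / norm z) *s z) = 1"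
      using \<open>z \<noteq> 0\<close> by (simp, simp add: cinner_self power2_eq_square)
  qed (use z in \<open>auto intro: vec.span_scale\<close>)
qed

section \<open>The antilinear operator of an antisymmetric unitary\<close>

locale antisymmetric_unitary =
  fixes e :: "nat \<Rightarrow> complex^'n"
    and \<Sigma> :: "(complex^'n) set"
    and U :: "complex^'n \<Rightarrow> complex^'n"
    and W :: "complex^'n^'n"
    and n :: nat
  assumes e: "orthonormal_basis e" and n_le: "n \<le> CARD('n)"
    and \<Sigma>: "\<Sigma> = vec.span (e ` {1..n})"
    and U: "unitary_on \<Sigma> U" and antisym: "antisymmetric_in {1..n} e U"
    and W: "zero_extension \<Sigma> U W"
begin

definition J :: "complex^'n \<Rightarrow> complex^'n" where
  "J x = W *v basis_cnj e x"

definition proj :: "complex^'n \<Rightarrow> complex^'n" where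
  "proj x = (\<Sum>i\<in>{1..n}. cinner (e i) x *s e i)"

section \<open>Projection onto \<Sigma> and the action of the extension\<close>

lemma basis_mem: "i \<in> {1..n} \<Longrightarrow> e i \<in> \<Sigma>"
  unfolding \<Sigma> by (intro vec.span_base imageI)

lemma zero_mem: "0 \<in> \<Sigma>"
  unfolding \<Sigma> by (rule vec.span_zero)

lemma proj_mem: "proj x \<in> \<Sigma>"
  unfolding proj_def \<Sigma> by (intro vec.span_sum vec.span_scale vec.span_base imageI)

lemma cinner_basis_proj: "j \<in> {1..n} \<Longrightarrow> cinner (e j) (proj x) = cinner (e j) x"
proof -
  assume j: "j \<in> {1..n}"
  have "cinner (e j) (proj x) = (\<Sum>i\<in>{1..n}. if i = j then cinner (e j) x else 0)"
    unfolding proj_def cinner_sum_right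
    using j n_le by (intro sum.cong) (auto simp: basis_cinner[OF e])
  with j show ?thesis by simp
qed

lemma orth_complI:
  assumes "\<And>i. i \<in> {1..n} \<Longrightarrow> cinner (e i) y = 0"
  shows "y \<in> orth_compl \<Sigma>"
proof -
  have "cinner x y = 0" if "x \<in> \<Sigma>" for x
    using that unfolding \<Sigma>
    by (induction rule: vec.span_induct_alt) (auto simp: cinner_add_left assms)
  then show ?thesis by (simp add: orth_compl_def)
qed

lemma diff_proj: "x - proj x \<in> orth_compl \<Sigma>"
  by (rule orth_complI) (simp add: cinner_diff_right cinner_basis_proj del: atLeastAtMost_iff)

lemma basis_orth: "i \<in> {1..CARD('n)} \<Longrightarrow> i \<notin> {1..n} \<Longrightarrow> e i \<in> orth_compl \<Sigma>"
  by (rule orth_complI) (use n_le in \<open>auto simp: basis_cinner[OF e]\<close>)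

lemma mult_vec_eq: "x \<in> \<Sigma> \<Longrightarrow> W *v x = U x"
  using W unfolding zero_extension_def
  by (metis add.right_neutral orth_complI cinner_zero_right)

lemma U_mem: "x \<in> \<Sigma> \<Longrightarrow> U x \<in> \<Sigma>"
  using U unfolding unitary_on_def by blast

lemma mult_vec_orth: "y \<in> orth_compl \<Sigma> \<Longrightarrow> W *v y = 0"
  using W zero_mem mult_vec_eq[OF zero_mem] unfolding zero_extension_def
  by (metis add.left_neutral matrix_vector_mult_0_right)

lemma mult_vec_proj: "W *v x = U (proj x)"
proof -
  have "W *v (proj x + (x - proj x)) = U (proj x)"
    using W proj_mem diff_proj unfolding zero_extension_def by blast
  then show ?thesis by simp
qed

section \<open>Range, norm and skewness of \<open>J\<close>\<close>

lemma J_mem: "J x \<in> \<Sigma>"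
  by (simp add: J_def mult_vec_proj U_mem proj_mem)

text \<open>Conjugation preserves norms, the projection onto \<Sigma> does not increase them
  (Pythagoras), and \<open>U\<close> preserves them on \<Sigma>.\<close>

lemma norm_J: "norm (J x) \<le> norm x"
proof -
  let ?p = "proj (basis_cnj e x)" and ?y = "basis_cnj e x"
  have "cinner (J x) (J x) = cinner ?p ?p"
    using U proj_mem by (simp add: J_def mult_vec_proj unitary_on_def)
  then have 1: "(norm (J x))\<^sup>2 = (norm ?p)\<^sup>2"
    unfolding cinner_self of_real_eq_iff .
  have "cinner ?p (?y - ?p) = 0"
    using diff_proj proj_mem by (auto simp: orth_compl_def)
  moreover from this have "cinner (?y - ?p) ?p = 0"
    by (metis cnj_cinner complex_cnj_zero)
  ultimately have "cinner ?y ?y = cinner ?p ?p + cinner (?y - ?p) (?y - ?p)"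
    by (simp add: cinner_diff_left cinner_diff_right)
  moreover have "cinner ?y ?y = cinner x x"
    by (rule cinner_basis_cnj_basis_cnj[OF e])
  ultimately have "(norm x)\<^sup>2 = (norm ?p)\<^sup>2 + (norm (?y - ?p))\<^sup>2"
    unfolding cinner_self by (metis of_real_add of_real_eq_iff)
  with 1 show ?thesis
    by (simp add: power2_le_imp_le)
qed

text \<open>The basis is adapted to \<Sigma>: coordinates beyond \<open>n\<close> vanish on
  \<Sigma>, and conjugation keeps them zero.\<close>

lemma basis_cnj_mem:
  assumes "x \<in> \<Sigma>"
  shows "basis_cnj e x \<in> \<Sigma>"
proof -
  have "cinner x (e i) *s e i \<in> \<Sigma>" if i: "i \<in> {1..CARD('n)}" for i
  proof (cases "i \<in> {1..n}")
    case True
    then show ?thesis unfolding \<Sigma> by (intro vec.span_scale vec.span_base imageI)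
  next
    case False
    then have "cinner x (e i) = 0"
      using basis_orth[OF i] assms by (simp add: orth_compl_def)
    then show ?thesis by (simp add: zero_mem)
  qed
  then show ?thesis
    unfolding basis_cnj_def \<Sigma> by (rule vec.span_sum)
qed

lemma cinner_J_J:
  assumes "x \<in> \<Sigma>" "y \<in> \<Sigma>"
  shows "cinner (J x) (J y) = cinner y x"
  using U assms basis_cnj_mem
  by (simp add: J_def mult_vec_eq unitary_on_def cinner_basis_cnj_basis_cnj[OF e])

lemma basis_antisym:
  assumes "i \<in> {1..CARD('n)}" "j \<in> {1..CARD('n)}"
  shows "cinner (e i) (W *v e j) = - cinner (e j) (W *v e i)"
proof -
  \<comment> \<open>An index beyond \<open>n\<close> makes both entries vanish, because
    \<open>W\<close> maps into \<Sigma> and kills its orthogonal complement.\<close>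
  have out: "cinner (e i) (W *v e j) = 0" "cinner (e j) (W *v e i) = 0"
    if "i \<in> {1..CARD('n)}" "i \<notin> {1..n}" for i j
  proof -
    have "cinner (W *v e j) (e i) = 0"
      using basis_orth[OF that] U_mem[OF proj_mem] by (simp add: orth_compl_def mult_vec_proj)
    then show "cinner (e i) (W *v e j) = 0"
      by (metis cnj_cinner complex_cnj_zero)
    show "cinner (e j) (W *v e i) = 0"
      by (simp add: mult_vec_orth[OF basis_orth[OF that]])
  qed
  show ?thesis
  proof (cases "i \<in> {1..n} \<and> j \<in> {1..n}")
    case True
    with antisym have "cinner (e i) (U (e j)) = - cinner (e j) (U (e i))"
      unfolding antisymmetric_in_def by blast
    with True show ?thesis
      by (metis mult_vec_eq basis_mem)
  next
    case False
    then show ?thesis using out assms by (metis neg_0_equal_iff_equal)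
  qed
qed

text \<open>In coordinates the pairing is bilinear in the conjugated coordinates, with the
  antisymmetric matrix of \<open>W\<close> as coefficients.\<close>

lemma J_skew: "cinner x (J y) = - cinner y (J x)"
proof -
  have form: "cinner x (J y) = (\<Sum>i\<in>{1..CARD('n)}. \<Sum>j\<in>{1..CARD('n)}.
      cinner x (e i) * cinner y (e j) * cinner (e i) (W *v e j))" for x y
  proof -
    have "cinner x (J y) = cinner (\<Sum>i\<in>{1..CARD('n)}. cinner (e i) x *s e i) (J y)"
      using basis_expand[OF e, of x] by simp
    also have "\<dots> = (\<Sum>i\<in>{1..CARD('n)}. \<Sum>j\<in>{1..CARD('n)}.
        cinner x (e i) * cinner y (e j) * cinner (e i) (W *v e j))"
      by (simp add: J_def basis_cnj_def mult_vec_sum vec.scale cinner_sum_left cinner_sum_right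
          sum_distrib_left mult_ac) (rule sum.swap)
    finally show ?thesis .
  qed
  have "- cinner y (J x) = (\<Sum>i\<in>{1..CARD('n)}. \<Sum>j\<in>{1..CARD('n)}.
      cinner x (e j) * cinner y (e i) * cinner (e j) (W *v e i))"
    unfolding form[of y x] sum_negf[symmetric]
    by (intro sum.cong refl, subst basis_antisym, assumption+, simp)
  also have "\<dots> = cinner x (J y)"
    unfolding form[of x y] by (rule sum.swap)
  finally show ?thesis ..
qed

text \<open>Skewness of \<open>J\<close> says that C W^* = -J; the two signs cancel in W X^T
  W^*.\<close>

lemma phi_map_form:
  "cinner u (phi_map e W X *v v) = trace X * cinner u v - cinner u (X *v v) - cinner (J v) (X *v J u)"
proof -
  have J: "basis_cnj e (madjoint W *v u) = - J u" for u
  proof (rule cinner_eq_rightI)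
    fix x
    have "cinner x (basis_cnj e (madjoint W *v u)) = cinner (madjoint W *v u) (basis_cnj e x)"
      by (metis cinner_basis_cnj_left[OF e] cnj_cinner)
    also have "\<dots> = cinner u (J x)"
      by (simp add: J_def flip: cinner_mult_vec)
    also have "\<dots> = cinner x (- J u)"
      using J_skew[of u x] by simp
    finally show "cinner x (basis_cnj e (madjoint W *v u)) = cinner x (- J u)" .
  qed
  have "cinner u ((W ** basis_transpose e X ** madjoint W) *v v)
      = cinner (madjoint W *v u) (basis_transpose e X *v (madjoint W *v v))"
    by (simp add: cinner_mult_vec flip: matrix_vector_mul_assoc)
  also have "\<dots> = cinner (- J v) (X *v (- J u))"
    by (simp add: basis_transpose_form[OF e] J)
  also have "\<dots> = cinner (J v) (X *v J u)"
    using matrix_vector_mult_diff_distrib[of X 0 "J u"] by simp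
  finally show ?thesis
    by (simp add: phi_map_def matrix_vector_mult_diff_rdistrib cinner_diff_right mat_mult_vec)
qed

lemma linear_map_phi_map: "linear_map (phi_map e W)"
proof -
  have "trace (msmult c X) = c * trace X" for c and X :: "complex^'n^'n"
    by (simp add: trace_def msmult_def sum_distrib_left)
  then show ?thesis
    unfolding linear_map_def
    by (intro conjI allI matrix_eq_cinnerI)
       (simp_all add: phi_map_form matrix_vector_mult_add_rdistrib cinner_add_right trace_add
        algebra_simps)
qed

lemma positive_map_phi_map: "positive_map (phi_map e W)"
proof -
  have orth: "cinner v (J v) = 0" for v
    using J_skew[of v v] by simp
  have "psd (phi_map e W X)" if "psd X" for X
    unfolding psd_def phi_map_form by (intro allI orthogonal_pair_psd that orth norm_J)
  then show ?thesis
    by (simp add: positive_map_def linear_map_phi_map)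
qed

lemma J_frame:
  assumes "n \<ge> 4"
  obtains f :: "nat \<Rightarrow> complex^'n"
  where "orthonormal_family {1..4} f"
    and "\<And>i j. i \<in> {1..4} \<Longrightarrow> j \<in> {1..4} \<Longrightarrow> cinner (f i) (J (f j)) =
      (if (i, j) \<in> {(2, 1), (4, 3)} then 1 else if (i, j) \<in> {(1, 2), (3, 4)} then -1 else 0)"
proof -
  have e123: "cinner (e i) (e j) = (if i = j then 1 else 0)" if "i \<in> {1,2,3}" "j \<in> {1,2,3}" for i j
    using that assms n_le by (intro basis_cinner[OF e]) auto
  have mem: "e i \<in> \<Sigma>" if "i \<in> {1,2,3}" for i
    using that assms by (intro basis_mem) auto
  have flip: "cinner y x = 0" if "cinner x y = 0" for x y :: "complex^'n"
    using that by (metis cnj_cinner complex_cnj_zero)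
  define f1 where "f1 = e 1"
  define f2 where "f2 = J f1"
  \<comment> \<open>Shifting by \<open>Suc\<close> selects \<open>e 2\<close> and
    \<open>e 3\<close>, a plane in \<Sigma> already orthogonal to \<open>f1\<close>; only
    orthogonality to \<open>f2\<close> is left to arrange.\<close>
  have "orthonormal_family {1, 2} (\<lambda>i. e (Suc i))"
    using e123 by (auto simp: orthonormal_family_def numeral_eq_Suc)
  from exists_unit_orthogonal[OF this, of f2] obtain f3
    where f3: "f3 \<in> vec.span {e 2, e 3}" "cinner f3 f3 = 1" "cinner f2 f3 = 0"
    by (auto simp: numeral_eq_Suc)
  define f4 where "f4 = J f3"
  have "vec.span {e 2, e 3} \<subseteq> \<Sigma>"
    using mem vec.span_mono[of "{e 2, e 3}" \<Sigma>] \<Sigma> by (auto simp: vec.span_span)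
  with f3(1) have mem3: "f3 \<in> \<Sigma>" by blast
  have mem1: "f1 \<in> \<Sigma>" and mem2: "f2 \<in> \<Sigma>" and mem4: "f4 \<in> \<Sigma>"
    by (simp_all add: f1_def mem f2_def f4_def J_mem)
  have c13: "cinner f1 f3 = 0"
    using f3(1) by (induction rule: vec.span_induct_alt) (auto simp: cinner_add_right f1_def e123)
  have c11: "cinner f1 f1 = 1"
    by (simp add: f1_def e123)
  have self: "cinner x (J x) = 0" for x
    using J_skew[of x x] by simp
  have c12: "cinner f1 f2 = 0" and c34: "cinner f3 f4 = 0"
    by (simp_all add: f2_def f4_def self)
  have c22: "cinner f2 f2 = 1" and c44: "cinner f4 f4 = 1" and c24: "cinner f2 f4 = 0"
    by (simp_all add: f2_def f4_def cinner_J_J mem1 mem3 c11 f3 flip[OF c13])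
  \<comment> \<open>Skewness moves \<open>J\<close> from \<open>f3\<close> to \<open>f1\<close>,
    leaving the product of \<open>f3\<close> with \<open>f2\<close>.\<close>
  have c14: "cinner f1 f4 = 0"
    using J_skew[of f1 f3] flip[OF f3(3)] by (simp add: f2_def f4_def)
  note orth = c11 c22 f3(2) c44 c12 c13 c14 f3(3) c24 c34
    flip[OF c12] flip[OF c13] flip[OF c14] flip[OF f3(3)] flip[OF c24] flip[OF c34]
  \<comment> \<open>Products with \<open>f1\<close>, \<open>f2\<close> and \<open>f3\<close> come
    from skewness; the one with \<open>f4\<close> comes from antiunitarity on \<Sigma>, since
    \<open>f4\<close> is \<open>J f3\<close>.\<close>
  have J2: "cinner f1 (J f2) = -1" "cinner f2 (J f2) = 0" "cinner f3 (J f2) = 0" "cinner f4 (J f2) = 0"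
    using J_skew[of f1 f2] J_skew[of f3 f2] cinner_J_J[OF mem3 mem2]
    by (simp_all add: self orth flip: f2_def f4_def)
  have J4: "cinner f1 (J f4) = 0" "cinner f2 (J f4) = 0" "cinner f3 (J f4) = -1" "cinner f4 (J f4) = 0"
    using J_skew[of f1 f4] J_skew[of f3 f4] cinner_J_J[OF mem1 mem4]
    by (simp_all add: self orth flip: f2_def f4_def)
  define f where "f i = (if i = 1 then f1 else if i = 2 then f2 else if i = 3 then f3 else f4)" for i :: nat
  have set4: "{1..4} = {1, 2, 3, 4::nat}" by auto
  show ?thesis
  proof (rule that[of f])
    show "orthonormal_family {1..4} f"
      unfolding set4 by (simp add: orthonormal_family_def f_def orth)
    show "cinner (f i) (J (f j)) =
      (if (i, j) \<in> {(2, 1), (4, 3)} then 1 else if (i, j) \<in> {(1, 2), (3, 4)} then -1 else 0)"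
      if "i \<in> {1..4}" "j \<in> {1..4}" for i j
      using that unfolding set4
      by (auto simp: f_def orth J2 J4 simp flip: f2_def f4_def)
  qed
qed

end

section \<open>The detecting functional\<close>

text \<open>
  With \<open>t i j k l\<close> the real part of \<open>\<langle>f k, \<phi>(|f i\<rangle>\<langle>f j|) (f l)\<rangle>\<close>, this is the pairing of the Choi matrix
  of \<open>\<phi>\<close> with the sum of the operators \<open>|\<psi>\<rangle>\<langle>\<psi>|\<close> for \<open>\<psi>\<close> among (writing \<open>ik\<close> for \<open>f i \<otimes> f k\<close>)
  \<open>11 + 33\<close>, \<open>11 + 44\<close>, \<open>22 + 33\<close>, \<open>22 + 44\<close>, \<open>14 + 32\<close>, \<open>13 - 42\<close>, \<open>24 - 31\<close>, \<open>23 + 41\<close>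
  and, twice each, \<open>12\<close>, \<open>21\<close>, \<open>34\<close>, \<open>43\<close>. Its partial transpose is the sum of those for
  \<open>13 + 31\<close>, \<open>14 + 41\<close>, \<open>23 + 32\<close>, \<open>24 + 42\<close>, \<open>12 + 34\<close>, \<open>12 - 43\<close>, \<open>21 - 34\<close>, \<open>21 + 43\<close>
  and, twice each, \<open>11\<close>, \<open>22\<close>, \<open>33\<close>, \<open>44\<close>; so both have Schmidt number at most 2.
\<close>

definition detector :: "(nat \<Rightarrow> nat \<Rightarrow> nat \<Rightarrow> nat \<Rightarrow> real) \<Rightarrow> real" where
  "detector t = 2 * (t 1 1 1 1 + t 2 2 2 2 + t 3 3 3 3 + t 4 4 4 4
      + t 1 1 2 2 + t 2 2 1 1 + t 3 3 4 4 + t 4 4 3 3)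
    + (t 1 1 3 3 + t 1 1 4 4 + t 2 2 3 3 + t 2 2 4 4 + t 3 3 1 1 + t 3 3 2 2 + t 4 4 1 1 + t 4 4 2 2)
    + (t 1 3 1 3 + t 3 1 3 1 + t 1 4 1 4 + t 4 1 4 1 + t 2 3 2 3 + t 3 2 3 2 + t 2 4 2 4 + t 4 2 4 2)
    + (t 1 3 4 2 + t 3 1 2 4) - (t 1 4 3 2 + t 4 1 2 3) - (t 2 3 4 1 + t 3 2 1 4)
    + (t 2 4 3 1 + t 4 2 1 3)"

text \<open>The hypothesis is the Choi form at \<open>f i\<close> \<otimes> \<open>f k\<close> plus
  \<open>s\<close> times \<open>f j\<close> \<otimes> \<open>f l\<close>. The instances are the
  listed vectors, and the last four are counted twice.\<close>

lemma detector_nonneg: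
  assumes "\<And>i j k l s. i \<in> {1..4} \<Longrightarrow> j \<in> {1..4} \<Longrightarrow> i \<noteq> j \<Longrightarrow>
    0 \<le> t i i k k + s * t i j k l + s * t j i l k + s\<^sup>2 * t j j l l"
  shows "0 \<le> detector t"
  \<comment> \<open>The arguments come in the order \<open>i j k s l\<close>. Taking
    \<open>s = 0\<close> leaves a single product vector, so the value 0 of \<open>l\<close> is a
    dummy.\<close>
  using assms[of 1 3 1 1 3] assms[of 1 4 1 1 4] assms[of 2 3 2 1 3] assms[of 2 4 2 1 4]
    assms[of 1 3 4 1 2] assms[of 1 4 3 "-1" 2] assms[of 2 3 4 "-1" 1] assms[of 2 4 3 1 1]
    assms[of 1 2 2 0 0] assms[of 2 1 1 0 0] assms[of 3 4 4 0 0] assms[of 4 3 3 0 0]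
  by (simp add: detector_def)

text \<open>Exchanging \<open>i\<close> and \<open>j\<close> in the cross terms is partial
  transposition; the same functional now splits along the second list of vectors.\<close>

lemma detector_nonneg_transposed:
  assumes "\<And>i j k l s. i \<in> {1..4} \<Longrightarrow> j \<in> {1..4} \<Longrightarrow> i \<noteq> j \<Longrightarrow>
    0 \<le> t i i k k + s * t j i k l + s * t i j l k + s\<^sup>2 * t j j l l"
  shows "0 \<le> detector t"
  using assms[of 1 3 3 1 1] assms[of 1 4 4 1 1] assms[of 2 3 3 1 2] assms[of 2 4 4 1 2]
    assms[of 1 3 2 1 4] assms[of 1 4 2 "-1" 3] assms[of 2 3 1 "-1" 4] assms[of 2 4 1 1 3]
    assms[of 1 2 1 0 0] assms[of 2 1 2 0 0] assms[of 3 4 3 0 0] assms[of 4 3 4 0 0]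
  by (simp add: detector_def)

definition map_entry ::
  "(nat \<Rightarrow> complex^'n) \<Rightarrow> (complex^'n^'n \<Rightarrow> complex^'n^'n) \<Rightarrow> nat \<Rightarrow> nat \<Rightarrow> nat \<Rightarrow> nat \<Rightarrow> real" where
  "map_entry f \<phi> i j k l = Re (cinner (f k) (\<phi> (ket_bra (f i) (f j)) *v f l))"

lemma detector_P_sub:
  assumes \<phi>: "\<phi> \<in> P_sub 2" and f: "orthonormal_family {1..4} f"
  shows "0 \<le> detector (map_entry f \<phi>)"
proof (rule detector_nonneg)
  fix i j k l :: nat and s :: real
  assume ij: "i \<in> {1..4}" "j \<in> {1..4}" "i \<noteq> j"
  let ?x = "\<lambda>a. if a = (0::nat) then f i else f j"
  \<comment> \<open>Only the test vectors carry the factor \<open>s\<close>, so \<open>?x\<close>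
    stays orthonormal; \<open>k\<close> and \<open>l\<close> are unrestricted.\<close>
  let ?y = "\<lambda>a. if a = (0::nat) then f k else of_real s *s f l"
  have "orthonormal_family {..<2} ?x"
    using f ij unfolding orthonormal_family_def by simp
  from P_sub_form[OF \<phi> this, of ?y]
  show "0 \<le> map_entry f \<phi> i i k k + s * map_entry f \<phi> i j k l + s * map_entry f \<phi> j i l k
      + s\<^sup>2 * map_entry f \<phi> j j l l"
    by (simp add: numeral_2_eq_2 complex_nonneg_Reals_iff map_entry_def vec.scale algebra_simps)
qed

lemma detector_P_sup:
  assumes e: "orthonormal_basis e" and \<phi>: "\<phi> \<in> P_sup e 2" and f: "orthonormal_family {1..4} f"
  shows "0 \<le> detector (map_entry f \<phi>)"
proof (rule detector_nonneg_transposed)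
  fix i j k l :: nat and s :: real
  assume ij: "i \<in> {1..4}" "j \<in> {1..4}" "i \<noteq> j"
  let ?x = "\<lambda>a. if a = (0::nat) then f i else f j"
  let ?y = "\<lambda>a. if a = (0::nat) then f k else of_real s *s f l"
  have "orthonormal_family {..<2} ?x"
    using f ij unfolding orthonormal_family_def by simp
  from P_sup_form[OF e \<phi> this, of ?y]
  show "0 \<le> map_entry f \<phi> i i k k + s * map_entry f \<phi> j i k l + s * map_entry f \<phi> i j l k
      + s\<^sup>2 * map_entry f \<phi> j j l l"
    by (simp add: numeral_2_eq_2 complex_nonneg_Reals_iff map_entry_def vec.scale algebra_simps)
qed

lemma (in antisymmetric_unitary) detector_phi_map:
  assumes "n \<ge> 4"
  obtains f where "orthonormal_family {1..4} f" "detector (map_entry f (phi_map e W)) = -8"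
proof -
  obtain f where f: "orthonormal_family {1..4} f"
    and fJ: "\<And>i j. i \<in> {1..4} \<Longrightarrow> j \<in> {1..4} \<Longrightarrow> cinner (f i) (J (f j)) =
      (if (i, j) \<in> {(2, 1), (4, 3)} then 1 else if (i, j) \<in> {(1, 2), (3, 4)} then -1 else 0)"
    using J_frame[OF assms] by metis
  have ff: "cinner (f i) (f j) = (if i = j then 1 else 0)" if "i \<in> {1..4}" "j \<in> {1..4}" for i j
    using f that unfolding orthonormal_family_def by blast
  have entry: "map_entry f (phi_map e W) i j k l = Re (cinner (f j) (f i) * cinner (f k) (f l)
      - cinner (f j) (f l) * cinner (f k) (f i)
      - cinner (f j) (J (f k)) * cnj (cinner (f i) (J (f l))))" for i j k l
    by (simp add: map_entry_def phi_map_form trace_ket_bra)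
  \<comment> \<open>The doubled entries vanish and the other diagonal ones add up to 8. The entries
    \<open>t i j i j\<close> contribute -8 through the term -X, and the signed ones another -8
    through \<open>J\<close>: their signs are matched to those of \<open>J\<close> on the
    frame.\<close>
  have "detector (map_entry f (phi_map e W)) = -8"
    unfolding detector_def entry by (simp add: ff fJ)
  with f show ?thesis by (rule that)
qed

theorem theorem4:
  fixes e :: "nat \<Rightarrow> complex^'n"
    and \<Sigma> :: "(complex^'n) set"
    and U :: "complex^'n \<Rightarrow> complex^'n"
    and U_hat :: "complex^'n^'n"
    and k :: nat
  assumes "CARD('n) \<ge> 4"
    and "vec.subspace \<Sigma>" and "vec.dim \<Sigma> = 2 * k" and "vec.dim \<Sigma> \<ge> 4"
    and "orthonormal_basis e" and "\<Sigma> = vec.span (e ` {1..2 * k})"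
    and "unitary_on \<Sigma> U" and "antisymmetric_in {1..2 * k} e U"
    and "zero_extension \<Sigma> U U_hat"
  shows "positive_map (phi_map e U_hat) \<and> atomic_map e (phi_map e U_hat)"
proof -
  \<comment> \<open>This makes 1, ..., 2k genuine basis indices; values of \<open>e\<close> beyond
    the dimension are arbitrary.\<close>
  have "2 * k \<le> CARD('n)"
    using vec.dim_subset_UNIV[of \<Sigma>] assms(3)
    by (simp add: vec.dimension_def card_cart_basis)
  then interpret antisymmetric_unitary e \<Sigma> U U_hat "2 * k"
    using assms by unfold_locales
  obtain f where f: "orthonormal_family {1..4} f"
    and neg: "detector (map_entry f (phi_map e U_hat)) = -8"
    using detector_phi_map assms(3,4) by (metis)
  have False
    if \<phi>: "\<phi>\<^sub>1 \<in> P_sub 2" "\<phi>\<^sub>2 \<in> P_sup e 2" "phi_map e U_hat = (\<lambda>X. \<phi>\<^sub>1 X + \<phi>\<^sub>2 X)" for \<phi>\<^sub>1 \<phi>\<^sub>2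
  proof -
    have "detector (map_entry f (phi_map e U_hat))
        = detector (map_entry f \<phi>\<^sub>1) + detector (map_entry f \<phi>\<^sub>2)"
      by (simp add: detector_def map_entry_def \<phi>(3) matrix_vector_mult_add_rdistrib cinner_add_right)
    then show False
      using neg detector_P_sub[OF \<phi>(1) f] detector_P_sup[OF assms(5) \<phi>(2) f] by simp
  qed
  then show ?thesis
    using positive_map_phi_map by (auto simp: atomic_map_def)
qed

end
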